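(* Let $\lambda_0,\lambda\in\{-1,0,1\}$ and let $U:\mathbb{H}^1_{\lambda_0}\to\mathbb{H}^1_\lambda$, $$U=\frac{1}{\sqrt{|F_1|^2-\lambda|F_2|^2}}\begin{pmatrix}F_1&\lambda\bar F_2\\ F_2&\bar F_1\end{pmatrix},\qquad |F_1|^2>\lambda|F_2|^2,$$ be a bundle map covering a holomorphic map $f:M_0\to M$ (so $\pi_\lambda\circ U=f\circ\pi_{\lambda_0}$), and let $\mathcal{A}=U^{-1}dU$. Let $s$ be the section $s(z)=\frac{1}{\sqrt{1-\lambda_0|z|^2}}\begin{pmatrix}1&\lambda_0\bar z\\ z&1\end{pmatrix}$ of $\pi_{\lambda_0}$, let $f_1=F_1\circ s$, and for $z$ not a zero of $f_1$ let $r_{f_1}(z)=\begin{pmatrix}\bar f_1/|f_1|&0\\0&f_1/|f_1|\end{pmatrix}\in\mathbb{H}^1_\lambda$. Let $\hat A=-\Gamma t_0+\frac i2(e\,t_--\bar e\,t_+)$ be the connection on $M$ built from $e=\frac{2dz}{1-\lambda|z|^2}$ and $\Gamma=-i\lambda\frac{z\,d\bar z-\bar z\,dz}{1-\lambda|z|^2}$. Then, away from the zeros of $f_1$ (where $r_{f_1}$ is possibly singular), $$f^*\hat A=r_{f_1}^{-1}\,(s^*\mathcal{A})\,r_{f_1}+r_{f_1}^{-1}dr_{f_1}.$$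
   Context: For $\mu\in\{-1,0,1\}$, $\mathbb{H}^1_\mu=\left\{\begin{pmatrix} z_1&\mu\bar z_2\\ z_2&\bar z_1\end{pmatrix}: |z_1|^2-\mu|z_2|^2=1\right\}$, with projection $\pi_\mu(h)=z_2/z_1$ onto the constant-curvature surface $M_\mu$ (Riemann sphere, $\mathbb{C}$, or unit disc for $\mu=-1,0,1$, metric $4dzd\bar z/(1-\mu|z|^2)^2$); $M_0=M_{\lambda_0}$, $M=M_\lambda$. The Lie algebra of $\mathbb{H}^1_\lambda$ has basis $t_0=-\frac{i}{2}\begin{pmatrix}1&0\\0&-1\end{pmatrix}$, $t_1=-\frac{i}{2}\begin{pmatrix}0&-\lambda\\1&0\end{pmatrix}$, $t_2=\frac12\begin{pmatrix}0&\lambda\\1&0\end{pmatrix}$, $t_\pm=t_1\pm it_2$. A bundle map sends fibres of $\pi_{\lambda_0}$ into fibres of $\pi_\lambda$. The section $s$ is defined where $1-\lambda_0|z|^2>0$ (only locally, on $\mathbb{C}$, when $\lambda_0=-1$). *)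

theory Defs
  imports "HOL-Analysis.Analysis"
begin

text \<open>2x2 complex matrices are rendered as complex^2^2 (rows indexed by 1,2).\<close>

definition mat2 :: "complex \<Rightarrow> complex \<Rightarrow> complex \<Rightarrow> complex \<Rightarrow> complex^2^2" where
  "mat2 a b c d = (\<chi> i j. if i = 1 then (if j = 1 then a else b) else (if j = 1 then c else d))"

definition msc :: "complex \<Rightarrow> complex^2^2 \<Rightarrow> complex^2^2" where
  "msc c A = (\<chi> i j. c * A $ i $ j)"

text \<open>The group H^1_mu.\<close>
definition Hgrp :: "real \<Rightarrow> (complex^2^2) set" where
  "Hgrp mu = {mat2 z1 (complex_of_real mu * cnj z2) z2 (cnj z1) | z1 z2.
                (cmod z1)^2 - mu * (cmod z2)^2 = 1}"

text \<open>Projection pi_mu(h) = z2/z1 (finite part of M_mu).\<close>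
definition proj :: "complex^2^2 \<Rightarrow> complex" where
  "proj h = h $ 2 $ 1 / h $ 1 $ 1"

text \<open>The section s of pi_mu, defined where 1 - mu |z|^2 > 0.\<close>
definition sect :: "real \<Rightarrow> complex \<Rightarrow> complex^2^2" where
  "sect mu z = msc (complex_of_real (1 / sqrt (1 - mu * (cmod z)^2)))
                   (mat2 1 (complex_of_real mu * cnj z) z 1)"

text \<open>The bundle map U built from F1, F2 (target parameter lam).\<close>
definition Umap :: "real \<Rightarrow> (complex^2^2 \<Rightarrow> complex) \<Rightarrow> (complex^2^2 \<Rightarrow> complex)
                      \<Rightarrow> complex^2^2 \<Rightarrow> complex^2^2" where
  "Umap lam F1 F2 h = msc (complex_of_real (1 / sqrt ((cmod (F1 h))^2 - lam * (cmod (F2 h))^2)))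
                          (mat2 (F1 h) (complex_of_real lam * cnj (F2 h)) (F2 h) (cnj (F1 h)))"

text \<open>r_{f1}(z) = diag(conj f1/|f1|, f1/|f1|).\<close>
definition rmat :: "(complex \<Rightarrow> complex) \<Rightarrow> complex \<Rightarrow> complex^2^2" where
  "rmat f1 z = mat2 (cnj (f1 z) / complex_of_real (cmod (f1 z))) 0
                    0 (f1 z / complex_of_real (cmod (f1 z)))"

text \<open>Lie algebra basis of H^1_lam.\<close>
definition t0 :: "complex^2^2" where
  "t0 = msc (- \<i> / 2) (mat2 1 0 0 (-1))"
definition t1 :: "real \<Rightarrow> complex^2^2" where
  "t1 lam = msc (- \<i> / 2) (mat2 0 (- complex_of_real lam) 1 0)"
definition t2 :: "real \<Rightarrow> complex^2^2" where
  "t2 lam = msc (1 / 2) (mat2 0 (complex_of_real lam) 1 0)"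
definition tplus :: "real \<Rightarrow> complex^2^2" where
  "tplus lam = t1 lam + msc \<i> (t2 lam)"
definition tminus :: "real \<Rightarrow> complex^2^2" where
  "tminus lam = t1 lam - msc \<i> (t2 lam)"

text \<open>One-forms on M (point w, tangent vector v):
  e = 2 dz/(1 - lam|z|^2), its conjugate, and Gamma.\<close>
definition form_e :: "real \<Rightarrow> complex \<Rightarrow> complex \<Rightarrow> complex" where
  "form_e lam w v = 2 * v / complex_of_real (1 - lam * (cmod w)^2)"
definition form_ebar :: "real \<Rightarrow> complex \<Rightarrow> complex \<Rightarrow> complex" where
  "form_ebar lam w v = 2 * cnj v / complex_of_real (1 - lam * (cmod w)^2)"
definition form_Gamma :: "real \<Rightarrow> complex \<Rightarrow> complex \<Rightarrow> complex" where
  "form_Gamma lam w v = - \<i> * complex_of_real lam * (w * cnj v - cnj w * v)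
                          / complex_of_real (1 - lam * (cmod w)^2)"

text \<open>The connection A-hat = -Gamma t0 + (i/2)(e t_- - ebar t_+) on M.\<close>
definition Ahat :: "real \<Rightarrow> complex \<Rightarrow> complex \<Rightarrow> complex^2^2" where
  "Ahat lam w v = msc (- form_Gamma lam w v) t0
     + msc (\<i> / 2) (msc (form_e lam w v) (tminus lam) - msc (form_ebar lam w v) (tplus lam))"

end

(*
  Write f_i = F_i o s. Where f_1 does not vanish, the covering condition says f = f_2 / f_1, and
  then the bundle map along s is the canonical section s_lam of M twisted by the phase r_{f1}:
      U(s z) r_{f1}(z) = s_lam (f z).
  The canonical section satisfies s_lam^{-1} d s_lam = A-hat, so the pull-back f^* A-hat is the
  Maurer-Cartan form of z |-> U(s z) r_{f1}(z), which the product rule turns into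
  r^{-1} (U^{-1} dU) r + r^{-1} dr.  The argument works for all real lam0, lam and uses
  holomorphy of f only through its real differentiability.
*)

theory Submission
  imports Defs
begin

lemma mat2_nth [simp]:
  "mat2 a b c d $ 1 $ 1 = a" "mat2 a b c d $ 1 $ 2 = b"
  "mat2 a b c d $ 2 $ 1 = c" "mat2 a b c d $ 2 $ 2 = d"
  by (simp_all add: mat2_def)

lemma mat2_eq_iff:
  "mat2 a b c d = mat2 a' b' c' d' \<longleftrightarrow> a = a' \<and> b = b' \<and> c = c' \<and> d = d'"
  by (metis mat2_nth)

lemma mat2_add: "mat2 a b c d + mat2 a' b' c' d' = mat2 (a + a') (b + b') (c + c') (d + d')"
  by (simp add: vec_eq_iff forall_2)

lemma mat2_diff: "mat2 a b c d - mat2 a' b' c' d' = mat2 (a - a') (b - b') (c - c') (d - d')"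
  by (simp add: vec_eq_iff forall_2)

lemma mat2_mult:
  "mat2 a b c d ** mat2 a' b' c' d'
     = mat2 (a * a' + b * c') (a * b' + b * d') (c * a' + d * c') (c * b' + d * d')"
  by (simp add: vec_eq_iff forall_2 matrix_matrix_mult_def sum_2)

lemma msc_mat2: "msc k (mat2 a b c d) = mat2 (k * a) (k * b) (k * c) (k * d)"
  by (simp add: vec_eq_iff forall_2 msc_def)

lemma det_mat2: "det (mat2 a b c d) = a * d - b * c"
  by (simp add: det_2)

lemma inner_complex_eq: "complex_of_real (x \<bullet> y) = (x * cnj y + cnj x * y) / 2"
  by (simp add: complex_eq_iff inner_complex_def)

lemma has_derivative_mat2:
  assumes "(a has_derivative a') (at x within S)" "(b has_derivative b') (at x within S)"
    and "(c has_derivative c') (at x within S)" "(d has_derivative d') (at x within S)"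
  shows "((\<lambda>x. mat2 (a x) (b x) (c x) (d x)) has_derivative
           (\<lambda>v. mat2 (a' v) (b' v) (c' v) (d' v))) (at x within S)"
proof -
  have "bounded_linear (\<lambda>((a, b), (c, d)). mat2 a b c d)"
    by (intro linear_conv_bounded_linear[THEN iffD1] linearI)
       (auto simp: vec_eq_iff forall_2 split: prod.splits)
  from bounded_linear.has_derivative[OF this has_derivative_Pair[OF
        has_derivative_Pair[OF assms(1,2)] has_derivative_Pair[OF assms(3,4)]]]
  show ?thesis by simp
qed

lemma differentiable_mat2:
  assumes "a differentiable (at x within S)" "b differentiable (at x within S)"
    and "c differentiable (at x within S)" "d differentiable (at x within S)"
  shows "(\<lambda>x. mat2 (a x) (b x) (c x) (d x)) differentiable (at x within S)"
proof -
  obtain a' b' c' d'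
    where "(a has_derivative a') (at x within S)" "(b has_derivative b') (at x within S)"
      and "(c has_derivative c') (at x within S)" "(d has_derivative d') (at x within S)"
    using assms unfolding differentiable_def by blast
  then show ?thesis
    by (rule differentiableI[OF has_derivative_mat2])
qed

lemma bounded_bilinear_matrix_mult:
  "bounded_bilinear
     ((**) :: 'a::{euclidean_space, real_algebra_1}^'n^'m \<Rightarrow> 'a^'k^'n \<Rightarrow> 'a^'k^'m)"
  unfolding bilinear_conv_bounded_bilinear[symmetric] bilinear_def
  by (auto intro!: linearI simp: matrix_add_ldistrib matrix_scalar_ac scalar_matrix_assoc
      vec_eq_iff matrix_matrix_mult_def sum.distrib distrib_left distrib_right scaleR_sum_right)

lemma matrix_inv_cancel:
  fixes A :: "'a::field^'n^'n"
  assumes "invertible A"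
  shows matrix_inv_mult_cancel_left: "matrix_inv A ** (A ** X) = X"
    and matrix_mult_inv_cancel_left: "A ** (matrix_inv A ** X) = X"
proof -
  have "A ** matrix_inv A = mat 1 \<and> matrix_inv A ** A = mat 1"
    using assms unfolding invertible_def matrix_inv_def by (rule someI_ex)
  then show "matrix_inv A ** (A ** X) = X" "A ** (matrix_inv A ** X) = X"
    by (simp_all add: matrix_mul_assoc)
qed

lemma mult_eq_imp_gauge_transform:
  fixes A B :: "'a::field^'n^'n"
  assumes eq: "(A ** B) ** X = Y ** B + A ** Z"
    and A: "invertible A" and B: "invertible B"
  shows "X = matrix_inv B ** (matrix_inv A ** Y) ** B + matrix_inv B ** Z"
proof -
  have "(A ** B) ** (matrix_inv B ** (matrix_inv A ** Y) ** B + matrix_inv B ** Z)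
          = Y ** B + A ** Z"
    using A B by (simp add: matrix_add_ldistrib matrix_inv_cancel flip: matrix_mul_assoc)
  then show ?thesis
    by (metis eq A B invertible_mult matrix_inv_mult_cancel_left)
qed

lemma maurer_cartan_mult:
  fixes U R :: "'a::real_normed_vector \<Rightarrow> 'b::{real_normed_field, euclidean_space}^'n^'n"
  assumes G: "(G has_derivative G') (at z)"
    and U: "U differentiable (at z)" and R: "R differentiable (at z)"
    and T: "open T" "z \<in> T" and GUR: "\<And>y. y \<in> T \<Longrightarrow> G y = U y ** R y"
    and inv: "invertible (G z)"
  shows "matrix_inv (G z) ** G' v
           = matrix_inv (R z) ** (matrix_inv (U z) ** frechet_derivative U (at z) v) ** R z
             + matrix_inv (R z) ** frechet_derivative R (at z) v"
proof -
  define U' R' where "U' = frechet_derivative U (at z)" and "R' = frechet_derivative R (at z)"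
  have GUz: "G z = U z ** R z"
    by (rule GUR[OF T(2)])
  have "(G has_derivative (\<lambda>u. U z ** R' u + U' u ** R z)) (at z)"
    using U R unfolding U'_def R'_def frechet_derivative_works
    by (intro has_derivative_transform_within_open[OF
          bounded_bilinear.FDERIV[OF bounded_bilinear_matrix_mult] T]) (simp_all add: GUR)
  then have "G' = (\<lambda>u. U z ** R' u + U' u ** R z)"
    by (rule has_derivative_unique[OF G])
  then have "(U z ** R z) ** (matrix_inv (G z) ** G' v) = U' v ** R z + U z ** R' v"
    unfolding GUz[symmetric] matrix_mult_inv_cancel_left[OF inv] by (simp add: add.commute)
  moreover have "det (U z) * det (R z) \<noteq> 0"
    using inv unfolding GUz by (simp add: invertible_det_nz det_mul)
  then have "invertible (U z)" "invertible (R z)"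
    by (simp_all add: invertible_det_nz)
  ultimately show ?thesis
    unfolding U'_def R'_def by (rule mult_eq_imp_gauge_transform)
qed

lemma Hgrp_det:
  assumes "h \<in> Hgrp mu"
  shows "det h = 1"
proof -
  obtain z1 z2 where h: "h = mat2 z1 (of_real mu * cnj z2) z2 (cnj z1)"
    and norm: "(cmod z1)^2 - mu * (cmod z2)^2 = 1"
    using assms unfolding Hgrp_def by blast
  have "complex_of_real ((cmod z1)^2 - mu * (cmod z2)^2) = 1"
    using norm by simp
  then have "z1 * cnj z1 - of_real mu * (z2 * cnj z2) = 1"
    by (simp only: of_real_diff of_real_mult complex_norm_square)
  then show ?thesis
    by (simp add: h det_mat2 algebra_simps)
qed

lemma sect_eq:
  "sect mu z = mat2 (of_real (1 / sqrt (1 - mu * (z \<bullet> z))))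
                    (of_real (1 / sqrt (1 - mu * (z \<bullet> z))) * (of_real mu * cnj z))
                    (of_real (1 / sqrt (1 - mu * (z \<bullet> z))) * z)
                    (of_real (1 / sqrt (1 - mu * (z \<bullet> z))))"
  by (simp add: sect_def msc_mat2 power2_norm_eq_inner)

lemma sect_in_Hgrp:
  assumes "1 - mu * (cmod z)^2 > 0"
  shows "sect mu z \<in> Hgrp mu"
proof -
  define k where "k = 1 / sqrt (1 - mu * (cmod z)^2)"
  have "sect mu z = mat2 (of_real k) (of_real mu * cnj (of_real k * z)) (of_real k * z)
                         (cnj (of_real k))"
    by (simp add: sect_def msc_mat2 k_def mult_ac)
  moreover have "(cmod (of_real k))^2 - mu * (cmod (of_real k * z))^2 = 1"
  proof -
    have "k^2 = 1 / (1 - mu * (cmod z)^2)"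
      using assms by (simp add: k_def power_divide)
    then show ?thesis
      using assms by (simp add: norm_mult power_mult_distrib field_simps)
  qed
  ultimately show ?thesis
    unfolding Hgrp_def by blast
qed

lemma proj_sect: "1 - mu * (cmod z)^2 > 0 \<Longrightarrow> proj (sect mu z) = z"
  by (simp add: proj_def sect_def msc_mat2)

lemma invertible_sect:
  assumes "1 - mu * (cmod w)^2 > 0"
  shows "invertible (sect mu w)"
  using Hgrp_det[OF sect_in_Hgrp[OF assms]] by (simp add: invertible_det_nz)

lemma Ahat_eq:
  "Ahat lam w u = msc (1 / complex_of_real (1 - lam * (cmod w)^2))
     (mat2 (of_real lam * (w * cnj u - cnj w * u) / 2) (of_real lam * cnj u)
           u (- of_real lam * (w * cnj u - cnj w * u) / 2))"
proof (cases "1 - lam * (cmod w)^2 = 0")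
  case True
  then show ?thesis
    by (simp add: Ahat_def form_e_def form_ebar_def form_Gamma_def msc_def vec_eq_iff)
next
  case False
  then have "complex_of_real (1 - lam * (cmod w)^2) \<noteq> 0"
    by (metis of_real_eq_0_iff)
  then show ?thesis
    unfolding Ahat_def form_e_def form_ebar_def form_Gamma_def t0_def tplus_def tminus_def
      t1_def t2_def
    by (simp add: msc_mat2 mat2_add mat2_diff mat2_eq_iff field_simps)
qed

lemma has_derivative_sect_scale:
  assumes "1 - mu * (w \<bullet> w) > 0"
  shows "((\<lambda>y. complex_of_real (1 / sqrt (1 - mu * (y \<bullet> y)))) has_derivative
           (\<lambda>u. of_real mu * (w * cnj u + cnj w * u)
                  / (2 * complex_of_real (sqrt (1 - mu * (w \<bullet> w)))^3))) (at w)"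
proof -
  have "((\<lambda>y. 1 / sqrt (1 - mu * (y \<bullet> y))) has_derivative
          (\<lambda>u. mu * (w \<bullet> u) / sqrt (1 - mu * (w \<bullet> w))^3)) (at w)"
    using assms
    by (auto intro!: derivative_eq_intros simp: field_simps power3_eq_cube inner_commute)
  then show ?thesis
    by (rule has_derivative_eq_rhs[OF has_derivative_of_real])
       (simp add: fun_eq_iff inner_complex_eq)
qed

lemma has_derivative_sect:
  assumes "1 - mu * (cmod w)^2 > 0"
  shows "(sect mu has_derivative (\<lambda>u. sect mu w ** Ahat mu w u)) (at w)"
proof -
  define c where "c = complex_of_real (sqrt (1 - mu * (w \<bullet> w)))"
  have w: "1 - mu * (w \<bullet> w) > 0"
    using assms by (simp add: power2_norm_eq_inner)
  have c: "c \<noteq> 0" "complex_of_real (1 - mu * (cmod w)^2) = c^2"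
    using w by (simp_all add: c_def power2_norm_eq_inner flip: of_real_power)
  then have c_sq: "c * c = 1 - of_real mu * (w * cnj w)"
    by (simp add: power2_eq_square flip: complex_norm_square)
  define dsect where "dsect u = mat2 (of_real mu * (w * cnj u + cnj w * u) / (2 * c^3))
        (of_real mu * (w * cnj u + cnj w * u) / (2 * c^3) * (of_real mu * cnj w)
           + 1 / c * (of_real mu * cnj u))
        (of_real mu * (w * cnj u + cnj w * u) / (2 * c^3) * w + 1 / c * u)
        (of_real mu * (w * cnj u + cnj w * u) / (2 * c^3))" for u
  have "(sect mu has_derivative dsect) (at w)"
    unfolding sect_eq[abs_def]
    by (rule has_derivative_eq_rhs, (rule has_derivative_mat2 has_derivative_sect_scale[OF w]
          has_derivative_mult has_derivative_const has_derivative_cnj has_derivative_ident)+)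
       (simp add: fun_eq_iff dsect_def c_def field_simps)
  moreover have "dsect = (\<lambda>u. sect mu w ** Ahat mu w u)"
  proof
    fix u
    have Ahat: "Ahat mu w u = msc (1 / c^2)
       (mat2 (of_real mu * (w * cnj u - cnj w * u) / 2) (of_real mu * cnj u)
             u (- of_real mu * (w * cnj u - cnj w * u) / 2))"
      by (simp only: Ahat_eq c(2))
    have sect_w: "sect mu w = mat2 (1 / c) (1 / c * (of_real mu * cnj w)) (1 / c * w) (1 / c)"
      by (simp add: sect_eq c_def)
    show "dsect u = sect mu w ** Ahat mu w u"
      unfolding dsect_def Ahat sect_w using c(1) c_sq
      by (simp add: msc_mat2 mat2_mult mat2_eq_iff field_simps power2_eq_square power3_eq_cube)
        algebra+
  qed
  ultimately show ?thesis
    by simp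
qed

lemma has_derivative_sect_comp:
  assumes "f differentiable (at z)" "1 - lam * (cmod (f z))^2 > 0"
  shows "((sect lam \<circ> f) has_derivative
           (\<lambda>u. sect lam (f z) ** Ahat lam (f z) (frechet_derivative f (at z) u))) (at z)"
  using diff_chain_at[OF assms(1)[unfolded frechet_derivative_works]
      has_derivative_sect[OF assms(2)]]
  by (simp add: o_def)

lemma sect_domain_open: "open {z. 1 - mu * (cmod z)^2 > 0}"
  by (intro open_Collect_less continuous_intros)

lemma differentiable_comp_sect:
  assumes F: "\<forall>h\<in>Hgrp mu. F differentiable (at h within Hgrp mu)"
    and z: "1 - mu * (cmod z)^2 > 0"
  shows "(F \<circ> sect mu) differentiable (at z)"
proof -
  define S where "S = {z. 1 - mu * (cmod z)^2 > 0}"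
  have S: "open S" "z \<in> S" "sect mu ` S \<subseteq> Hgrp mu"
    unfolding S_def using sect_domain_open z sect_in_Hgrp by blast+
  have "sect mu differentiable (at z within S)"
    by (rule differentiableI[OF has_derivative_at_withinI[OF has_derivative_sect[OF z]]])
  moreover have "F differentiable (at (sect mu z) within Hgrp mu)"
    using F sect_in_Hgrp[OF z] by blast
  then have "F differentiable (at (sect mu z) within sect mu ` S)"
    by (rule differentiable_within_subset[OF _ S(3)])
  ultimately have "(F \<circ> sect mu) differentiable (at z within S)"
    by (rule differentiable_chain_within)
  then show ?thesis
    by (simp only: at_within_open[OF S(2,1)])
qed

lemma open_sect_nonvanishing:
  assumes "\<forall>h\<in>Hgrp mu. F differentiable (at h within Hgrp mu)"
  shows "open {z. 1 - mu * (cmod z)^2 > 0 \<and> F (sect mu z) \<noteq> 0}"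
proof -
  define S where "S = {z. 1 - mu * (cmod z)^2 > 0}"
  have "(F \<circ> sect mu) differentiable_on S"
    unfolding differentiable_on_def S_def
    using differentiable_comp_sect[OF assms] differentiable_at_withinI by blast
  then have "continuous_on S (F \<circ> sect mu)"
    by (rule differentiable_imp_continuous_on)
  moreover have "open S"
    unfolding S_def by (rule sect_domain_open)
  ultimately have "open (S \<inter> (F \<circ> sect mu) -` (- {0}))"
    by (rule continuous_open_preimage) (rule open_Compl, simp)
  moreover have "S \<inter> (F \<circ> sect mu) -` (- {0})
                   = {z. 1 - mu * (cmod z)^2 > 0 \<and> F (sect mu z) \<noteq> 0}"
    by (auto simp: S_def)
  ultimately show ?thesis
    by simp
qed

lemma proj_Umap:
  assumes "F1 h \<noteq> 0" "lam * (cmod (F2 h))^2 < (cmod (F1 h))^2"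
  shows "proj (Umap lam F1 F2 h) = F2 h / F1 h"
  using assms by (simp add: proj_def Umap_def msc_mat2)

lemma quotient_in_sect_domain:
  assumes "a \<noteq> 0" "lam * (cmod b)^2 < (cmod a)^2"
  shows "1 - lam * (cmod (b / a))^2 > 0"
  using assms by (simp add: norm_divide power_divide field_simps)

lemma Umap_mult_rmat:
  assumes f1: "f1 z = F1 h" and nz: "F1 h \<noteq> 0"
    and pos: "lam * (cmod (F2 h))^2 < (cmod (F1 h))^2"
  shows "Umap lam F1 F2 h ** rmat f1 z = sect lam (F2 h / F1 h)"
proof -
  define a b where "a = F1 h" and "b = F2 h"
  define N m where "N = sqrt ((cmod a)^2 - lam * (cmod b)^2)" and "m = cmod a"
  have a: "a \<noteq> 0" and N: "N > 0" and m: "m > 0"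
    using nz pos by (simp_all add: N_def m_def a_def b_def)
  have "sqrt (1 - lam * (cmod (b / a))^2) = N / m"
    using N m a pos by (intro real_sqrt_unique)
      (simp_all add: N_def m_def a_def b_def norm_divide power_divide field_simps)
  then have sect: "sect lam (b / a)
      = mat2 (of_real (m / N)) (of_real (m / N) * (of_real lam * cnj (b / a)))
             (of_real (m / N) * (b / a)) (of_real (m / N))"
    by (simp add: sect_def msc_mat2)
  have U: "Umap lam F1 F2 h = mat2 (a / of_real N) (of_real lam * cnj b / of_real N)
                                   (b / of_real N) (cnj a / of_real N)"
    by (simp add: Umap_def msc_mat2 N_def a_def b_def)
  have r: "rmat f1 z = mat2 (cnj a / of_real m) 0 0 (a / of_real m)"
    by (simp add: rmat_def f1 a_def m_def)
  have "a * cnj a = of_real m * of_real m"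
    by (simp add: m_def flip: complex_norm_square of_real_mult power2_eq_square)
  then have "cnj a = of_real m * of_real m / a"
    using a by (simp add: field_simps)
  then show ?thesis
    unfolding a_def[symmetric] b_def[symmetric] sect U r mat2_mult mat2_eq_iff complex_cnj_divide
    using a N m by (simp add: field_simps)
qed

lemma sect_comp_cover:
  assumes pos: "\<forall>h\<in>Hgrp lam0. (cmod (F1 h))^2 > lam * (cmod (F2 h))^2"
    and cover: "\<forall>h\<in>Hgrp lam0. h $ 1 $ 1 \<noteq> 0 \<and> F1 h \<noteq> 0
                   \<longrightarrow> proj (Umap lam F1 F2 h) = f (proj h)"
    and y: "1 - lam0 * (cmod y)^2 > 0" and nz: "F1 (sect lam0 y) \<noteq> 0"
  shows "1 - lam * (cmod (f y))^2 > 0"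
    and "sect lam (f y) = Umap lam F1 F2 (sect lam0 y) ** rmat (F1 \<circ> sect lam0) y"
proof -
  have h: "sect lam0 y \<in> Hgrp lam0"
    by (rule sect_in_Hgrp[OF y])
  then have pos_y: "lam * (cmod (F2 (sect lam0 y)))^2 < (cmod (F1 (sect lam0 y)))^2"
    using pos by blast
  have "sect lam0 y $ 1 $ 1 \<noteq> 0"
    using y by (simp add: sect_def msc_def)
  then have "proj (Umap lam F1 F2 (sect lam0 y)) = f (proj (sect lam0 y))"
    using cover h nz by blast
  then have "proj (Umap lam F1 F2 (sect lam0 y)) = f y"
    by (simp only: proj_sect[OF y])
  then have f: "f y = F2 (sect lam0 y) / F1 (sect lam0 y)"
    using proj_Umap[of F1 "sect lam0 y" lam F2, OF nz pos_y] by simp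
  show "1 - lam * (cmod (f y))^2 > 0"
    unfolding f by (rule quotient_in_sect_domain[OF nz pos_y])
  show "sect lam (f y) = Umap lam F1 F2 (sect lam0 y) ** rmat (F1 \<circ> sect lam0) y"
    unfolding f
    by (rule Umap_mult_rmat[of "F1 \<circ> sect lam0" y F1 "sect lam0 y" lam F2,
          symmetric, OF _ nz pos_y]) simp
qed

lemma differentiable_Umap_comp:
  assumes "(F1 \<circ> g) differentiable (at z)" "(F2 \<circ> g) differentiable (at z)"
    and "lam * (cmod (F2 (g z)))^2 < (cmod (F1 (g z)))^2"
  shows "(Umap lam F1 F2 \<circ> g) differentiable (at z)"
proof -
  obtain D1 D2 where D1: "((\<lambda>y. F1 (g y)) has_derivative D1) (at z)"
    and D2: "((\<lambda>y. F2 (g y)) has_derivative D2) (at z)"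
    using assms(1,2) by (auto simp: differentiable_def o_def)
  have "(\<lambda>y. complex_of_real (1 / sqrt ((cmod (F1 (g y)))^2 - lam * (cmod (F2 (g y)))^2)))
          differentiable (at z)"
    using assms(3) unfolding power2_norm_eq_inner
    by (intro differentiableI) (auto intro!: derivative_eq_intros D1 D2)
  then show ?thesis
    unfolding Umap_def msc_mat2 o_def
    by (intro differentiable_mat2 differentiable_mult differentiable_const
        differentiable_cnj_iff[THEN iffD2] assms(1,2)[unfolded o_def])
qed

lemma differentiable_rmat:
  assumes f1: "f1 differentiable (at z)" and nz: "f1 z \<noteq> 0"
  shows "rmat f1 differentiable (at z)"
proof -
  obtain D where "((\<lambda>y. cmod (f1 y)) has_derivative D) (at z)"
    using differentiable_compose[OF differentiable_norm_at[OF nz] f1]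
    by (auto simp: differentiable_def)
  then have norm: "(\<lambda>y. complex_of_real (cmod (f1 y))) differentiable (at z)"
    by (rule differentiableI[OF has_derivative_of_real])
  have "complex_of_real (cmod (f1 z)) \<noteq> 0"
    using nz by simp
  note quotient = differentiable_divide[OF _ norm this]
  show ?thesis
    unfolding rmat_def[abs_def]
    by (rule differentiable_mat2[OF quotient differentiable_const differentiable_const quotient])
       (simp_all add: f1 differentiable_cnj_iff)
qed

lemma pullback_Ahat_eq_gauge_transform:
  fixes lam0 lam :: real
    and F1 F2 :: "complex^2^2 \<Rightarrow> complex"
    and f :: "complex \<Rightarrow> complex"
  assumes pos: "\<forall>h\<in>Hgrp lam0. (cmod (F1 h))^2 > lam * (cmod (F2 h))^2"
    and smooth: "\<forall>h\<in>Hgrp lam0. F1 differentiable (at h within Hgrp lam0)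
                               \<and> F2 differentiable (at h within Hgrp lam0)"
    and cover: "\<forall>h\<in>Hgrp lam0. h $ 1 $ 1 \<noteq> 0 \<and> F1 h \<noteq> 0
                   \<longrightarrow> proj (Umap lam F1 F2 h) = f (proj h)"
    and holo: "f holomorphic_on {z. 1 - lam0 * (cmod z)^2 > 0 \<and> F1 (sect lam0 z) \<noteq> 0}"
    and z: "1 - lam0 * (cmod z)^2 > 0" and nz: "(F1 \<circ> sect lam0) z \<noteq> 0"
  shows "Ahat lam (f z) (frechet_derivative f (at z) v)
           = matrix_inv (rmat (F1 \<circ> sect lam0) z)
               ** (matrix_inv (Umap lam F1 F2 (sect lam0 z))
                   ** frechet_derivative (Umap lam F1 F2 \<circ> sect lam0) (at z) v)
               ** rmat (F1 \<circ> sect lam0) z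
             + matrix_inv (rmat (F1 \<circ> sect lam0) z)
               ** frechet_derivative (rmat (F1 \<circ> sect lam0)) (at z) v"
proof -
  define T where "T = {z. 1 - lam0 * (cmod z)^2 > 0 \<and> F1 (sect lam0 z) \<noteq> 0}"
  have smooth1: "\<forall>h\<in>Hgrp lam0. F1 differentiable (at h within Hgrp lam0)"
    and smooth2: "\<forall>h\<in>Hgrp lam0. F2 differentiable (at h within Hgrp lam0)"
    using smooth by blast+
  have T: "open T" "z \<in> T"
    unfolding T_def using open_sect_nonvanishing[OF smooth1] z nz by simp_all
  note covered = sect_comp_cover[OF pos cover]
  have disc: "1 - lam * (cmod (f z))^2 > 0"
    using covered(1) z nz by simp
  have gauge: "(sect lam \<circ> f) y
      = (Umap lam F1 F2 \<circ> sect lam0) y ** rmat (F1 \<circ> sect lam0) y" if "y \<in> T" for y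
    using covered(2) that by (simp add: T_def)
  have "f differentiable (at z)"
    using holomorphic_on_imp_differentiable_at[OF holo T[unfolded T_def]]
    by (rule field_differentiable_imp_differentiable)
  note chain = has_derivative_sect_comp[OF this disc]
  have dF1: "(F1 \<circ> sect lam0) differentiable (at z)"
    and dF2: "(F2 \<circ> sect lam0) differentiable (at z)"
    using differentiable_comp_sect smooth1 smooth2 z by blast+
  have pos_z: "lam * (cmod (F2 (sect lam0 z)))^2 < (cmod (F1 (sect lam0 z)))^2"
    using pos sect_in_Hgrp[OF z] by simp
  show ?thesis
    using maurer_cartan_mult[OF chain differentiable_Umap_comp[OF dF1 dF2 pos_z]
        differentiable_rmat[OF dF1 nz] T gauge]
      invertible_sect[OF disc]
    by (simp add: matrix_inv_mult_cancel_left comp_def)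
qed

theorem corollary4p5:
  fixes lam0 lam :: real
    and F1 F2 :: "complex^2^2 \<Rightarrow> complex"
    and f :: "complex \<Rightarrow> complex"
  assumes lam0: "lam0 \<in> {-1, 0, 1}"
    and lam: "lam \<in> {-1, 0, 1}"
    and pos: "\<forall>h\<in>Hgrp lam0. (cmod (F1 h))^2 > lam * (cmod (F2 h))^2"
    and smooth: "\<forall>h\<in>Hgrp lam0. F1 differentiable (at h within Hgrp lam0)
                               \<and> F2 differentiable (at h within Hgrp lam0)"
    and cover: "\<forall>h\<in>Hgrp lam0. h $ 1 $ 1 \<noteq> 0 \<and> F1 h \<noteq> 0
                   \<longrightarrow> proj (Umap lam F1 F2 h) = f (proj h)"
    and holo: "f holomorphic_on {z. 1 - lam0 * (cmod z)^2 > 0 \<and> F1 (sect lam0 z) \<noteq> 0}"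
  shows "\<forall>z. 1 - lam0 * (cmod z)^2 > 0 \<and> (F1 \<circ> sect lam0) z \<noteq> 0 \<longrightarrow>
           (\<forall>v. Ahat lam (f z) (frechet_derivative f (at z) v)
                = matrix_inv (rmat (F1 \<circ> sect lam0) z)
                    ** (matrix_inv (Umap lam F1 F2 (sect lam0 z))
                        ** frechet_derivative (Umap lam F1 F2 \<circ> sect lam0) (at z) v)
                    ** rmat (F1 \<circ> sect lam0) z
                  + matrix_inv (rmat (F1 \<circ> sect lam0) z)
                    ** frechet_derivative (rmat (F1 \<circ> sect lam0)) (at z) v)"
  using pullback_Ahat_eq_gauge_transform[OF pos smooth cover holo] by blast

end
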